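(* Let $F:\mathbb{R}^n\to\mathbb{R}^m$ and $\mathbb{L}:\mathbb{R}^m\to\mathbb{R}$ be the inner and outer functions of a sigmoid network problem $\min_{\theta\in\mathbb{R}^n}\mathbb{L}(F(\theta))$ (see context). Let $\beta\in[1,2]$ and $r>0$. Let $\{\theta_k\}$ be a sequence generated by the linearized proximal algorithm (LPA) with parameter $t$ and initial point $\theta_0$, and let $\bar\theta\in\mathbb{R}^n$ be such that $F(\bar\theta)\in C_{\mathbb{L}}$ and $C_{\mathbb{L}}$ is the set of weak sharp minima of order $\beta$ for $\mathbb{L}$ on the open ball $B(F(\bar\theta),r)$. If $\bar\theta$ is a regular point of the inclusion $F(\theta)\in C_{\mathbb{L}}$, then there exist $t_0\ge 0$ and $\bar r>0$ such that for any $t>t_0$ and any initial point $\theta_0\in B(\bar\theta,\bar r)$, the sequence $\{\theta_k\}$ converges at a rate of $\frac{2}{\beta}$ to a globally optimal solution $\theta^*$ of $\min_{\theta\in\mathbb{R}^n}\mathbb{L}(F(\theta))$, and $F(\theta^* )\in C_{\mathbb{L}}$.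
   Context: **Sigmoid network.** Let $\sigma(a)=1/(1+e^{-a})$. For parameters $\theta=(w_1,\dots,w_q,v_1,\dots,v_q,u_1,\dots,u_q,w_0)\in\mathbb{R}^n$, where $w_i,u_i,w_0\in\mathbb{R}$, $v_i\in\mathbb{R}^d$ and $n=(d+2)q+1$, set $f(x;\theta)=\sum_{i=1}^q w_i\,\sigma(v_i\cdot x+u_i)+w_0$ for $x\in\mathbb{R}^d$. Training data $(x_i,y_i)\in\mathbb{R}^d\times\mathbb{R}$, $i=1,\dots,m$, are given. **Inner and outer functions.** Training the network is written as $\min_{\theta\in\mathbb{R}^n}\mathbb{L}(F(\theta))$ with $F:\mathbb{R}^n\to\mathbb{R}^m$ smooth and $\mathbb{L}:\mathbb{R}^m\to\mathbb{R}$ convex. Specifically: for the quadratic ($p=2$) or absolute ($p=1$) loss, $F(\theta)=(f(x_i;\theta)-y_i)_{i=1}^m$ and $\mathbb{L}(z)=\frac1m\|z\|_p^p$; for the hinge loss, $F(\theta)=(y_if(x_i;\theta))_{i=1}^m$ and $\mathbb{L}(z)=\frac1m\sum_{i=1}^m\max(1-z_i,0)$. In all these cases $\mathbb{L}(z)=\frac1m\sum_{i=1}^m\ell(z_i)$ with $\ell:\mathbb{R}\to[0,\infty)$ convex. $F'(\theta)\in\mathbb{R}^{m\times n}$ is the Jacobian matrix of $F$, $\|\cdot\|$ is the Euclidean norm, and $B(z,r)$ is the open ball of radius $r$ centered at $z$. **LPA.** Given $t>0$ and $\theta_0\in\mathbb{R}^n$, for $k=0,1,2,\dots$ let $$\Delta\theta_k=\arg\min_{\Delta\theta\in\mathbb{R}^n}\Big\{\mathbb{L}(F(\theta_k)+F'(\theta_k)\Delta\theta)+\tfrac1{2t}\|\Delta\theta\|^2\Big\};$$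 set $\theta_{k+1}=\theta_k+\Delta\theta_k$, and stop if $\Delta\theta_k=0$. **Minima.** $\mathbb{L}_{\min}=\min_{z\in\mathbb{R}^m}\mathbb{L}(z)$ and $C_{\mathbb{L}}=\arg\min_{z\in\mathbb{R}^m}\mathbb{L}(z)$. **Weak sharp minima.** Let $C_{\mathbb{L}}\subseteq S\subseteq\mathbb{R}^m$. If there exist $\alpha>0$ and $\beta\ge1$ such that $\mathbb{L}(z)\ge\mathbb{L}_{\min}+\alpha\,\mathrm{dist}^\beta(z,C_{\mathbb{L}})$ for each $z\in S$, where $\mathrm{dist}(z,C)=\inf_{c\in C}\|z-c\|$, then $C_{\mathbb{L}}$ is called the set of weak sharp minima of order $\beta$ for $\mathbb{L}$ on $S$ with modulus $\alpha$. **Regular point.** $\bar\theta$ is a regular point of the inclusion $F(\theta)\in C_{\mathbb{L}}$ if $\ker(F'(\bar\theta)^T)\cap(C_{\mathbb{L}}-F(\bar\theta))^{\ominus}=\{0\}$, where $Z^{\ominus}=\{y:\langle y,z\rangle\le0\ \forall z\in Z\}$ is the negative polar of $Z$. **Rate.** "Rate of $2/\beta$" refers to the order of convergence (rate $1$ is linear convergence, rate $2$ is quadratic convergence); no more specific definition is fixed. *)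

theory Defs
  imports "HOL-Analysis.Analysis"
begin

definition sigmoid :: "real \<Rightarrow> real" where
  "sigmoid a = 1 / (1 + exp (- a))"

text \<open>
  The finite types \<open>'q\<close>, \<open>'d\<close>, \<open>'m\<close> index the hidden units, the coordinates of the inputs and the
  training samples.  A parameter vector \<open>(w\<^sub>i)\<^sub>i, (v\<^sub>i)\<^sub>i, (u\<^sub>i)\<^sub>i, w\<^sub>0\<close> is a Euclidean vector,
  indexed by the sum of the four index types of its blocks.
\<close>

type_synonym ('q, 'd) param_idx = "'q + ('q \<times> 'd) + 'q + unit"

lemma CARD_param_idx:
  "CARD(('q::finite, 'd::finite) param_idx) = (CARD('d) + 2) * CARD('q) + 1"
  by (simp add: card_UNIV_sum algebra_simps)

definition weight_w :: "real ^ ('q::finite, 'd::finite) param_idx \<Rightarrow> 'q \<Rightarrow> real" where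
  "weight_w \<theta> i = \<theta> $ Inl i"

definition weight_v :: "real ^ ('q::finite, 'd::finite) param_idx \<Rightarrow> 'q \<Rightarrow> real ^ 'd" where
  "weight_v \<theta> i = (\<chi> j. \<theta> $ Inr (Inl (i, j)))"

definition bias_u :: "real ^ ('q::finite, 'd::finite) param_idx \<Rightarrow> 'q \<Rightarrow> real" where
  "bias_u \<theta> i = \<theta> $ Inr (Inr (Inl i))"

definition bias_w0 :: "real ^ ('q::finite, 'd::finite) param_idx \<Rightarrow> real" where
  "bias_w0 \<theta> = \<theta> $ Inr (Inr (Inr ()))"

definition network ::
    "real ^ ('q::finite, 'd::finite) param_idx \<Rightarrow> real ^ 'd \<Rightarrow> real" where
  "network \<theta> x =
     (\<Sum>i\<in>UNIV. weight_w \<theta> i * sigmoid (weight_v \<theta> i \<bullet> x + bias_u \<theta> i)) + bias_w0 \<theta>"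

datatype loss = Quadratic | Absolute | Hinge

fun inner_fn ::
    "loss \<Rightarrow> ('m::finite \<Rightarrow> real ^ 'd::finite) \<Rightarrow> ('m \<Rightarrow> real) \<Rightarrow>
     real ^ ('q::finite, 'd) param_idx \<Rightarrow> real ^ 'm" where
  "inner_fn Quadratic x y \<theta> = (\<chi> i. network \<theta> (x i) - y i)"
| "inner_fn Absolute x y \<theta> = (\<chi> i. network \<theta> (x i) - y i)"
| "inner_fn Hinge x y \<theta> = (\<chi> i. y i * network \<theta> (x i))"

fun outer_fn :: "loss \<Rightarrow> real ^ 'm::finite \<Rightarrow> real" where
  "outer_fn Quadratic z = (norm z)\<^sup>2 / real CARD('m)"
| "outer_fn Absolute z = (\<Sum>i\<in>UNIV. \<bar>z $ i\<bar>) / real CARD('m)"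
| "outer_fn Hinge z = (\<Sum>i\<in>UNIV. max (1 - z $ i) 0) / real CARD('m)"

definition minimizers :: "('a \<Rightarrow> real) \<Rightarrow> 'a set" where
  "minimizers h = {z. is_arg_min h (\<lambda>_. True) z}"

lemma minimizers_iff: "z \<in> minimizers h \<longleftrightarrow> (\<forall>z'. h z \<le> h z')"
  by (auto simp: minimizers_def is_arg_min_linorder)

text \<open>
  The inclusion \<open>minimizers h \<subseteq> S\<close> that often accompanies this notion is not required: it is
  not meant for a small ball \<open>S\<close> when the set of minimizers is unbounded, as it is for the hinge loss.
\<close>

definition weak_sharp_minima :: "real \<Rightarrow> ('a::metric_space \<Rightarrow> real) \<Rightarrow> 'a set \<Rightarrow> bool" where
  "weak_sharp_minima \<beta> h S \<longleftrightarrow> \<beta> \<ge> 1 \<and>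
     (\<exists>\<alpha>>0. \<forall>z\<in>S. h z \<ge> (INF w. h w) + \<alpha> * infdist z (minimizers h) powr \<beta>)"

text \<open>
  For the outer functions the minimum is attained, so \<open>INF w. h w\<close> is the minimum value and \<open>infdist\<close>
  (which is \<open>0\<close> for the empty set) is the actual distance.
\<close>

lemma outer_fn_nonneg: "outer_fn l z \<ge> 0"
  by (cases l) (auto intro!: divide_nonneg_nonneg sum_nonneg)

lemma minimizers_outer_fn_nonempty: "minimizers (outer_fn l :: real ^ 'm::finite \<Rightarrow> real) \<noteq> {}"
proof -
  have "\<exists>z :: real ^ 'm. outer_fn l z = 0"
  proof (cases l)
    case Hinge
    then show ?thesis by (intro exI[of _ "\<chi> i. 1"]) simp
  qed (auto intro!: exI[of _ 0])
  then show ?thesis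
    by (metis empty_iff minimizers_iff outer_fn_nonneg)
qed

lemma INF_eq_minimum:
  assumes "z \<in> minimizers h"
  shows "(INF w. h w) = h z"
  using assms by (intro cInf_eq_minimum) (auto simp: minimizers_iff)

definition neg_polar :: "'a::real_inner set \<Rightarrow> 'a set" where
  "neg_polar Z = {y. \<forall>z\<in>Z. y \<bullet> z \<le> 0}"

definition regular_point ::
    "(real ^ 'n \<Rightarrow> real ^ 'm) \<Rightarrow> (real ^ 'm) set \<Rightarrow> real ^ 'n \<Rightarrow> bool" where
  "regular_point F C \<theta> \<longleftrightarrow>
     {y. transpose (jacobian F (at \<theta>)) *v y = 0} \<inter> neg_polar ((\<lambda>c. c - F \<theta>) ` C) = {0}"

definition lpa_objective ::
    "(real ^ 'n \<Rightarrow> real ^ 'm) \<Rightarrow> (real ^ 'm \<Rightarrow> real) \<Rightarrow> real \<Rightarrow> real ^ 'n \<Rightarrow> real ^ 'n \<Rightarrow> real" where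
  "lpa_objective F L t \<theta> \<Delta> =
     L (F \<theta> + jacobian F (at \<theta>) *v \<Delta>) + 1 / (2 * t) * (norm \<Delta>)\<^sup>2"

text \<open>
  Stopping as soon as the step is \<open>0\<close> is modelled by an iteration that remains constant: the
  subproblem then no longer changes, and its minimizer is unique (for convex \<open>L\<close> and \<open>t > 0\<close>).
\<close>

definition lpa_sequence ::
    "(real ^ 'n \<Rightarrow> real ^ 'm) \<Rightarrow> (real ^ 'm \<Rightarrow> real) \<Rightarrow> real \<Rightarrow> real ^ 'n \<Rightarrow>
     (nat \<Rightarrow> real ^ 'n) \<Rightarrow> bool" where
  "lpa_sequence F L t \<theta>0 \<theta> \<longleftrightarrow> \<theta> 0 = \<theta>0 \<and>
     (\<forall>k. \<exists>\<Delta>. is_arg_min (lpa_objective F L t (\<theta> k)) (\<lambda>_. True) \<Delta> \<and> \<theta> (Suc k) = \<theta> k + \<Delta>)"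

lemma continuous_on_outer_fn: "continuous_on S (outer_fn l :: real ^ 'm::finite \<Rightarrow> real)"
proof (cases l)
  case Quadratic
  then have "outer_fn l = (\<lambda>z :: real ^ 'm. (norm z)\<^sup>2 / real CARD('m))" by (simp add: fun_eq_iff)
  then show ?thesis by (simp only:) (intro continuous_intros, simp)
next
  case Absolute
  then have "outer_fn l = (\<lambda>z :: real ^ 'm. (\<Sum>i\<in>UNIV. \<bar>z $ i\<bar>) / real CARD('m))"
    by (simp add: fun_eq_iff)
  then show ?thesis by (simp only:) (intro continuous_intros, simp)
next
  case Hinge
  then have "outer_fn l = (\<lambda>z :: real ^ 'm. (\<Sum>i\<in>UNIV. max (1 - z $ i) 0) / real CARD('m))"
    by (simp add: fun_eq_iff)
  then show ?thesis by (simp only:) (intro continuous_intros, simp)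
qed

lemma lpa_step_exists:
  fixes F :: "real ^ 'n \<Rightarrow> real ^ 'm"
  assumes "t > 0"
  shows "\<exists>\<Delta>. is_arg_min (lpa_objective F (outer_fn l) t \<theta>) (\<lambda>_. True) \<Delta>"
proof -
  define g where "g = lpa_objective F (outer_fn l) t \<theta>"
  define R where "R = sqrt (2 * t * g 0)"
  have g_ge: "g \<Delta> \<ge> (norm \<Delta>)\<^sup>2 / (2 * t)" for \<Delta>
    by (simp add: g_def lpa_objective_def outer_fn_nonneg)
  have g0: "g 0 \<ge> 0" using g_ge[of 0] by simp
  have "continuous_on (cball 0 R) g"
    unfolding g_def lpa_objective_def
    by (intro continuous_intros continuous_on_compose2[OF continuous_on_outer_fn[of UNIV]]
        linear_continuous_on matrix_vector_mul_bounded_linear) auto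
  moreover have "R \<ge> 0" using g0 assms by (simp add: R_def)
  ultimately obtain \<Delta> where min: "\<forall>\<Delta>'\<in>cball 0 R. g \<Delta> \<le> g \<Delta>'"
    using continuous_attains_inf[of "cball 0 R" g] by fastforce
  have "g \<Delta> \<le> g \<Delta>'" for \<Delta>'
  proof (cases "\<Delta>' \<in> cball 0 R")
    case False
    then have "R\<^sup>2 \<le> (norm \<Delta>')\<^sup>2"
      using \<open>R \<ge> 0\<close> by (intro power_mono) auto
    moreover have "R\<^sup>2 = 2 * t * g 0" using assms g0 by (simp add: R_def)
    ultimately have "g 0 \<le> (norm \<Delta>')\<^sup>2 / (2 * t)" using assms by (simp add: field_simps)
    also have "\<dots> \<le> g \<Delta>'" by (rule g_ge)
    finally show ?thesis using bspec[OF min, of 0] \<open>R \<ge> 0\<close> by simp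
  qed (use min in blast)
  then show ?thesis unfolding g_def by (auto simp: is_arg_min_linorder)
qed

lemma lpa_sequence_exists:
  fixes F :: "real ^ 'n \<Rightarrow> real ^ 'm"
  assumes "t > 0"
  shows "\<exists>\<theta>. lpa_sequence F (outer_fn l) t \<theta>0 \<theta>"
proof -
  have "\<forall>\<theta>. \<exists>\<Delta>. is_arg_min (lpa_objective F (outer_fn l) t \<theta>) (\<lambda>_. True) \<Delta>"
    using lpa_step_exists[OF assms] by blast
  from choice[OF this] obtain step where
    "\<And>\<theta>. is_arg_min (lpa_objective F (outer_fn l) t \<theta>) (\<lambda>_. True) (step \<theta>)"
    by blast
  then show ?thesis
    by (intro exI[of _ "rec_nat \<theta>0 (\<lambda>_ \<theta>. \<theta> + step \<theta>)"]) (auto simp: lpa_sequence_def)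
qed

text \<open>
  Q-convergence of order \<open>p \<ge> 1\<close>: \<open>p = 1\<close> is Q-linear convergence, which needs a factor
  smaller than \<open>1\<close>, and \<open>p = 2\<close> is Q-quadratic convergence.
\<close>

definition converges_at_rate ::
    "(nat \<Rightarrow> 'a::real_normed_vector) \<Rightarrow> 'a \<Rightarrow> real \<Rightarrow> bool" where
  "converges_at_rate s l p \<longleftrightarrow> s \<longlonglongrightarrow> l \<and>
     (\<exists>c. (p = 1 \<longrightarrow> c < 1) \<and>
        (\<forall>\<^sub>F k in sequentially. norm (s (Suc k) - l) \<le> c * norm (s k - l) powr p))"

end

theory Submission
  imports Defs
begin

text \<open>
  Let \<open>C\<close> be the set of minimizers of the outer function and \<open>d(\<theta>) = dist(F(\<theta>), C)\<close>.  By
  separation, regularity says that \<open>0\<close> is an interior point of \<open>F'(\<theta>bar) B - ((C \<inter> B') - F(\<theta>bar))\<close>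
  with \<open>B\<close>, \<open>B'\<close> closed unit balls around \<open>0\<close> and \<open>F(\<theta>bar)\<close>.  This property is stable under
  perturbation, so for \<open>\<theta>\<close> near \<open>\<theta>bar\<close> the inclusion \<open>F(\<theta>) + F'(\<theta>) h \<in> C\<close> has a
  solution with \<open>norm h \<le> \<kappa> d(\<theta>)\<close>.  Comparing the LPA step \<open>\<Delta>\<close> with \<open>h\<close> gives
  \<open>norm \<Delta> \<le> \<kappa> d(\<theta>)\<close> and, by weak sharpness, \<open>dist(F(\<theta>) + F'(\<theta>) \<Delta>, C) \<le> \<eta> d(\<theta>) powr (2/\<beta>)\<close>
  with \<open>\<eta>\<close> small for large \<open>t\<close>.  As the linearization error is quadratic, \<open>d\<close> decays along
  the iteration with order \<open>2/\<beta>\<close> and the steps are summable.  The iterates inherit the rate, since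
  the distance to their limit is comparable to \<open>d\<close>: it is at most \<open>2 \<kappa> d\<close>, and \<open>d\<close> is
  Lipschitz and vanishes at the limit.
\<close>

section \<open>Solvability of linearized inclusions\<close>

text \<open>This is \<open>A B - (S - z)\<close> with \<open>B\<close> the closed unit ball. In the
  applications \<open>S\<close> is compact, so that the set is compact too and small changes of
  \<open>A\<close> and \<open>z\<close> move it only slightly.\<close>

definition residual_set ::
    "('a::real_normed_vector \<Rightarrow> 'b::real_normed_vector) \<Rightarrow> 'b \<Rightarrow> 'b set \<Rightarrow> 'b set" where
  "residual_set A z S = {A h - (s - z) | h s. h \<in> cball 0 1 \<and> s \<in> S}"

lemma residual_set_eq:
  "residual_set A z S = {x - y | x y. x \<in> A ` cball 0 1 \<and> y \<in> (\<lambda>s. s - z) ` S}"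
  unfolding residual_set_def by blast

lemma compact_residual_set:
  fixes A :: "'a::euclidean_space \<Rightarrow> 'b::euclidean_space"
  assumes "linear A" "compact S"
  shows "compact (residual_set A z S)"
  unfolding residual_set_eq using assms
  by (intro compact_differences compact_continuous_image continuous_intros linear_continuous_on)
    (auto simp: linear_linear)

lemma convex_residual_set:
  assumes "linear A" "convex S"
  shows "convex (residual_set A z S)"
proof -
  have "residual_set A z S = (\<Union>x\<in>A ` cball 0 1. \<Union>y\<in>(\<lambda>s. s - z) ` S. {x - y})"
    unfolding residual_set_eq by blast
  also have "convex \<dots>"
    using assms by (intro convex_differences convex_linear_image convex_translation_subtract) auto
  finally show ?thesis .
qed

text \<open>If \<open>0\<close> were not interior, some nonzero \<open>a\<close> would have
  nonnegative inner product with all residuals. Symmetry of the unit ball makes \<open>a\<close>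
  orthogonal to the range of \<open>A\<close>, the choice \<open>h = 0\<close> puts it into the
  negative polar, and regularity forces \<open>a = 0\<close>.\<close>

lemma cball_subset_residual_set:
  fixes A :: "'a::euclidean_space \<Rightarrow> 'b::euclidean_space"
  assumes A: "linear A" and C: "closed C" "convex C" "z \<in> C"
    and regular: "\<And>y. (\<And>h. y \<bullet> A h = 0) \<Longrightarrow> y \<in> neg_polar ((\<lambda>c. c - z) ` C) \<Longrightarrow> y = 0"
  shows "\<exists>\<eta>>0. cball 0 \<eta> \<subseteq> residual_set A z (C \<inter> cball z 1)"
proof (rule ccontr)
  define K where "K = residual_set A z (C \<inter> cball z 1)"
  assume "\<not> (\<exists>\<eta>>0. cball 0 \<eta> \<subseteq> residual_set A z (C \<inter> cball z 1))"
  then have not_int: "0 \<notin> interior K" by (auto simp: mem_interior_cball K_def)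
  have convK: "convex K"
    unfolding K_def by (intro convex_residual_set A convex_Int C convex_cball)
  have K0: "0 \<in> K"
    unfolding K_def residual_set_def using C linear_0[OF A] by (auto intro!: exI[of _ 0] exI[of _ z])
  \<comment> \<open>A convex \<open>K\<close> with empty interior lies in a hyperplane, which passes
    through \<open>0\<close> because \<open>0 \<in> K\<close>. Otherwise the interior is separated
    from \<open>0\<close>, and the inequality extends to its closure, which contains
    \<open>K\<close>.\<close>
  have "\<exists>a. a \<noteq> 0 \<and> (\<forall>k\<in>K. 0 \<le> a \<bullet> k)"
  proof (cases "interior K = {}")
    case True
    then obtain a b where "a \<noteq> 0" "K \<subseteq> {k. a \<bullet> k = b}"
      using empty_interior_subset_hyperplane[OF convK] by metis
    moreover from this K0 have "b = 0" by auto
    ultimately show ?thesis by (intro exI[of _ a]) auto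
  next
    case False
    obtain a where a: "a \<noteq> 0" "\<forall>k\<in>interior K. 0 \<le> a \<bullet> k"
      using separating_hyperplane_set_0[OF convex_interior[OF convK] not_int] by auto
    have "closure (interior K) \<subseteq> {k. 0 \<le> a \<bullet> k}"
      using a(2) by (intro closure_minimal) (auto simp: closed_halfspace_ge)
    then show ?thesis
      using convex_closure_interior[OF convK False] a(1) closure_subset[of K] by auto
  qed
  then obtain a where a: "a \<noteq> 0" "\<And>k. k \<in> K \<Longrightarrow> 0 \<le> a \<bullet> k" by blast
  have ball: "0 \<le> a \<bullet> (A h - (c - z))" if "norm h \<le> 1" "c \<in> C" "norm (c - z) \<le> 1" for h c
    using that by (intro a(2)) (auto simp: K_def residual_set_def dist_norm norm_minus_commute)
  have nonneg: "0 \<le> a \<bullet> A h" for h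
  proof (cases "h = 0")
    case False
    have "0 \<le> a \<bullet> A (h /\<^sub>R norm h)" using ball[of "h /\<^sub>R norm h" z] C False by simp
    then show ?thesis using False by (simp add: linear_scale[OF A] zero_le_divide_iff field_simps zero_le_mult_iff)
  qed (use linear_0[OF A] in simp)
  have "a \<bullet> A h = 0" for h
    using nonneg[of h] nonneg[of "- h"] by (simp add: linear_neg[OF A])
  moreover have "a \<bullet> (c - z) \<le> 0" if "c \<in> C" for c
  proof (cases "c = z")
    case False
    \<comment> \<open>The factor pulls \<open>c\<close> towards \<open>z\<close> into the unit ball,
      where \<open>ball\<close> applies. Truncating \<open>C\<close> therefore loses no direction of
      the polar condition.\<close>
    define l where "l = 1 / (1 + norm (c - z))"
    have l: "0 < l" "l \<le> 1" "l * norm (c - z) \<le> 1"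
      by (auto simp: l_def add_pos_nonneg field_simps)
    have eq: "(1 - l) *\<^sub>R z + l *\<^sub>R c = z + l *\<^sub>R (c - z)" by (simp add: algebra_simps)
    have "z + l *\<^sub>R (c - z) \<in> C"
      using convexD_alt[OF C(2) C(3) that, of l] l eq by simp
    then have "0 \<le> - l * (a \<bullet> (c - z))"
      using ball[of 0 "z + l *\<^sub>R (c - z)"] l linear_0[OF A] by simp
    then show ?thesis using l(1) by (simp add: mult_le_0_iff)
  qed simp
  ultimately have "a = 0" by (intro regular) (auto simp: neg_polar_def)
  with a(1) show False by simp
qed

text \<open>A point of the smaller ball outside \<open>K'\<close> would be strictly separated from
  \<open>K'\<close> by some \<open>a\<close>. But the point of \<open>cball 0 \<eta>\<close> lowest
  in direction \<open>a\<close> has a neighbour in \<open>K'\<close>, which is on the wrong side of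
  the hyperplane.\<close>

lemma cball_subset_perturb:
  fixes K K' :: "'a::euclidean_space set"
  assumes ball: "cball 0 \<eta> \<subseteq> K" and K': "convex K'" "closed K'" and "0 \<le> \<eta>"
    and close: "\<And>k. k \<in> K \<Longrightarrow> \<exists>k'\<in>K'. norm (k' - k) \<le> \<epsilon>"
  shows "cball 0 (\<eta> - \<epsilon>) \<subseteq> K'"
proof
  fix z :: 'a assume z: "z \<in> cball 0 (\<eta> - \<epsilon>)"
  show "z \<in> K'"
  proof (rule ccontr)
    assume "z \<notin> K'"
    then obtain a b where ab: "a \<bullet> z < b" "\<And>k. k \<in> K' \<Longrightarrow> b < a \<bullet> k"
      using separating_hyperplane_closed_point[OF K'] by blast
    define p where "p = - (\<eta> *\<^sub>R sgn a)"
    have "norm p \<le> \<eta>" using assms(4) by (simp add: p_def norm_sgn)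
    then obtain k' where k': "k' \<in> K'" "norm (k' - p) \<le> \<epsilon>"
      using close[of p] ball by (auto simp: subset_iff)
    have "a \<bullet> k' = a \<bullet> p + a \<bullet> (k' - p)" by (simp add: inner_diff_right)
    also have "a \<bullet> p = - \<eta> * norm a"
      by (cases "a = 0") (simp_all add: p_def sgn_div_norm power2_eq_square flip: power2_norm_eq_inner)
    also have "a \<bullet> (k' - p) \<le> norm a * \<epsilon>"
      using norm_cauchy_schwarz[of a "k' - p"] mult_left_mono[OF k'(2), of "norm a"] by simp
    finally have "a \<bullet> k' \<le> - (norm a * (\<eta> - \<epsilon>))" by (simp add: algebra_simps)
    moreover have "- (norm a * (\<eta> - \<epsilon>)) \<le> a \<bullet> z"
    proof -
      have "- (a \<bullet> z) \<le> norm a * norm z" using norm_cauchy_schwarz[of "- a" z] by simp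
      also have "\<dots> \<le> norm a * (\<eta> - \<epsilon>)" using z by (intro mult_left_mono) auto
      finally show ?thesis by simp
    qed
    ultimately show False using ab(1) ab(2)[OF k'(1)] by linarith
  qed
qed

text \<open>
  A residual pointing away from \<open>C\<close> is averaged with the projection residual so that the two cancel;
  the weight of the former, hence the length of the step, is proportional to the distance.
\<close>

lemma solvability_of_cball_subset:
  fixes A :: "'a::euclidean_space \<Rightarrow> 'b::euclidean_space"
  assumes A: "linear A" and C: "closed C" "convex C" and S: "S \<subseteq> C" "S \<noteq> {}"
    and ball: "cball 0 \<eta> \<subseteq> residual_set A z S" and "\<eta> > 0"
  shows "\<exists>h. z + A h \<in> C \<and> norm h \<le> infdist z C / \<eta>"
proof -
  have "C \<noteq> {}" using S by auto
  then obtain c0 where c0: "c0 \<in> C" "infdist z C = dist z c0"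
    using infdist_attains_inf[OF C(1)] by blast
  define d where "d = infdist z C"
  have d: "d = norm (z - c0)" using c0 by (simp add: d_def dist_norm)
  show ?thesis
  proof (cases "d = 0")
    case True
    then show ?thesis using c0 d linear_0[OF A] by (intro exI[of _ 0]) (auto simp: d_def)
  next
    case False
    then have "d > 0" by (simp add: d)
    define w where "w = (- (\<eta> / d)) *\<^sub>R (z - c0)"
    have "norm w \<le> \<eta>" using \<open>\<eta> > 0\<close> \<open>d > 0\<close> by (simp add: w_def flip: d)
    then obtain h s where hs: "w = A h - (s - z)" "norm h \<le> 1" "s \<in> S"
      using ball by (auto simp: subset_iff residual_set_def)
    \<comment> \<open>The weight solves \<open>(1 - l) * d = l * \<eta>\<close>, which makes
      \<open>(1 - l) *\<^sub>R (z - c0) + l *\<^sub>R w\<close> vanish.\<close>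
    define l where "l = d / (d + \<eta>)"
    have l: "0 < l" "l \<le> 1" "l \<le> d / \<eta>" "(1 - l) = l * (\<eta> / d)"
      using \<open>\<eta> > 0\<close> \<open>d > 0\<close> by (auto simp: l_def field_simps)
    have "(1 - l) *\<^sub>R c0 + l *\<^sub>R s \<in> C"
      using convexD_alt[OF C(2) c0(1), of s l] hs(3) S(1) l(1,2) by auto
    moreover have "(1 - l) *\<^sub>R c0 + l *\<^sub>R s = z + A (l *\<^sub>R h)"
    proof -
      have "A h = s - z - (\<eta> / d) *\<^sub>R (z - c0)" using hs(1) by (simp add: w_def algebra_simps)
      then have "A (l *\<^sub>R h) = l *\<^sub>R (s - z) - (1 - l) *\<^sub>R (z - c0)"
        by (simp add: linear_scale[OF A] l(4) scaleR_diff_right)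
      then show ?thesis by (simp add: algebra_simps)
    qed
    moreover have "norm (l *\<^sub>R h) \<le> d / \<eta>"
    proof -
      have "norm (l *\<^sub>R h) \<le> l * 1" using l hs(2) by (simp add: mult_left_mono)
      then show ?thesis using l(3) by simp
    qed
    ultimately show ?thesis unfolding d_def by metis
  qed
qed

section \<open>Convergence of iterations controlled by a halving error function\<close>

text \<open>As the error halves, \<open>\<kappa> * d (s k)\<close> is at most
  \<open>2 * \<kappa> * (d (s k) - d (s (Suc k)))\<close>, so the step lengths telescope and
  \<open>2 * \<kappa> * d (s k)\<close> bounds all travel after \<open>s k\<close>. The initial
  radius keeps this travel inside the ball.\<close>

lemma geometric_error_convergence:
  fixes s :: "nat \<Rightarrow> 'a::banach" and d :: "'a \<Rightarrow> real"
  assumes d_nonneg: "\<And>u. 0 \<le> d u" and d0: "d u0 = 0"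
    and lip: "\<And>u v. u \<in> ball u0 \<delta> \<Longrightarrow> v \<in> ball u0 \<delta> \<Longrightarrow> \<bar>d u - d v\<bar> \<le> N * norm (u - v)"
    and pos: "\<kappa> > 0" "N > 0" "\<delta> > 0"
    and step: "\<And>k. s k \<in> ball u0 \<delta> \<Longrightarrow>
      norm (s (Suc k) - s k) \<le> \<kappa> * d (s k) \<and> d (s (Suc k)) \<le> d (s k) / 2"
    and init: "s 0 \<in> ball u0 (\<delta> / (2 * (1 + 2 * \<kappa> * N)))"
  shows "\<exists>l\<in>ball u0 \<delta>. s \<longlonglongrightarrow> l \<and> d l = 0 \<and>
    (\<forall>k. s k \<in> ball u0 \<delta> \<and> norm (s k - l) \<le> 2 * \<kappa> * d (s k))"
proof -
  have fac: "1 + 2 * \<kappa> * N > 1" using pos by simp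
  have "norm (s 0 - u0) < \<delta> / (2 * (1 + 2 * \<kappa> * N))"
    using init by (simp add: dist_norm norm_minus_commute)
  then have init': "(1 + 2 * \<kappa> * N) * norm (s 0 - u0) < \<delta> / 2"
    using fac by (simp add: field_simps)
  have norm_le: "norm (s 0 - u0) \<le> (1 + 2 * \<kappa> * N) * norm (s 0 - u0)"
    using fac mult_right_mono[of 1 "1 + 2 * \<kappa> * N" "norm (s 0 - u0)"] by simp
  have "s 0 \<in> ball u0 \<delta>" using norm_le init' pos by (simp add: dist_norm norm_minus_commute)
  then have ds0: "d (s 0) \<le> N * norm (s 0 - u0)"
    using lip[of "s 0" u0] d0 pos by simp
  \<comment> \<open>Since \<open>d (s 0) \<le> N * norm (s 0 - u0)\<close>, the travel budget plus
    the initial distance is at most \<open>1 + 2 * \<kappa> * N\<close> times the latter, hence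
    below \<open>\<delta> / 2\<close>.\<close>
  have cball: "v \<in> cball u0 (\<delta> / 2)" if "norm (v - s 0) \<le> 2 * \<kappa> * d (s 0)" for v
  proof -
    have d_le: "2 * \<kappa> * d (s 0) \<le> 2 * \<kappa> * (N * norm (s 0 - u0))"
      using pos by (intro mult_left_mono ds0) auto
    have "norm (v - u0) \<le> norm (v - s 0) + norm (s 0 - u0)"
      using norm_triangle_ineq[of "v - s 0" "s 0 - u0"] by simp
    also have "\<dots> \<le> 2 * \<kappa> * (N * norm (s 0 - u0)) + norm (s 0 - u0)"
      using that d_le by linarith
    also have "\<dots> = (1 + 2 * \<kappa> * N) * norm (s 0 - u0)" by (simp add: algebra_simps)
    finally show ?thesis using init' by (simp add: dist_norm norm_minus_commute)
  qed
  have half: "v \<in> ball u0 \<delta>" if "v \<in> cball u0 (\<delta> / 2)" for v using that pos by simp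
  \<comment> \<open>The subtracted term \<open>d (s k)\<close> is what lets the induction close;
    dropping it afterwards gives the confinement.\<close>
  have near: "norm (s k - s 0) \<le> 2 * \<kappa> * (d (s 0) - d (s k))" for k
  proof (induction k)
    case (Suc k)
    have "2 * \<kappa> * (d (s 0) - d (s k)) \<le> 2 * \<kappa> * d (s 0)" using pos d_nonneg[of "s k"] by simp
    then have "s k \<in> ball u0 \<delta>" using Suc by (intro half cball) linarith
    note st = step[OF this]
    have "norm (s (Suc k) - s 0) \<le> norm (s (Suc k) - s k) + norm (s k - s 0)"
      using norm_triangle_ineq[of "s (Suc k) - s k" "s k - s 0"] by simp
    also have "\<dots> \<le> \<kappa> * d (s k) + 2 * \<kappa> * (d (s 0) - d (s k))" using st Suc by simp
    also have "\<dots> \<le> 2 * \<kappa> * (d (s 0) - d (s (Suc k)))"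
      using mult_left_mono[of "d (s (Suc k))" "d (s k) / 2" "2 * \<kappa>"] st pos by (simp add: algebra_simps)
    finally show ?case .
  qed simp
  have in_half: "s k \<in> cball u0 (\<delta> / 2)" for k
  proof -
    have "2 * \<kappa> * (d (s 0) - d (s k)) \<le> 2 * \<kappa> * d (s 0)" using pos d_nonneg[of "s k"] by simp
    then show ?thesis using near[of k] by (intro cball) linarith
  qed
  note in_ball = half[OF in_half]
  have tail: "norm (s (k + j) - s k) \<le> 2 * \<kappa> * (d (s k) - d (s (k + j)))" for k j
  proof (induction j)
    case (Suc j)
    note st = step[OF in_ball[of "k + j"]]
    have "norm (s (k + Suc j) - s k) \<le> norm (s (Suc (k + j)) - s (k + j)) + norm (s (k + j) - s k)"
      using norm_triangle_ineq[of "s (Suc (k + j)) - s (k + j)" "s (k + j) - s k"] by simp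
    also have "\<dots> \<le> \<kappa> * d (s (k + j)) + 2 * \<kappa> * (d (s k) - d (s (k + j)))" using st Suc by simp
    also have "\<dots> \<le> 2 * \<kappa> * (d (s k) - d (s (Suc (k + j))))"
      using mult_left_mono[of "d (s (Suc (k + j)))" "d (s (k + j)) / 2" "2 * \<kappa>"] st pos
      by (simp add: algebra_simps)
    finally show ?case by simp
  qed simp
  have tail': "norm (s n - s k) \<le> 2 * \<kappa> * d (s k)" if "k \<le> n" for k n
  proof -
    have "2 * \<kappa> * (d (s k) - d (s n)) \<le> 2 * \<kappa> * d (s k)" using pos d_nonneg[of "s n"] by simp
    then show ?thesis using tail[of k "n - k"] that by simp
  qed
  have decay: "d (s k) \<le> d (s 0) * (1 / 2) ^ k" for k
  proof (induction k)
    case (Suc k)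
    then show ?case using step[OF in_ball[of k]] by simp
  qed simp
  have "(\<lambda>k. d (s 0) * (1 / 2) ^ k) \<longlonglongrightarrow> 0"
    by (intro tendsto_mult_right_zero LIMSEQ_power_zero) simp
  then have d_lim: "(\<lambda>k. d (s k)) \<longlonglongrightarrow> 0"
    by (rule tendsto_sandwich[rotated 3]) (auto simp: d_nonneg decay)
  have "Cauchy s"
  proof (rule metric_CauchyI)
    fix e :: real assume "e > 0"
    have "(\<lambda>k. 2 * \<kappa> * d (s k)) \<longlonglongrightarrow> 0" by (intro tendsto_mult_right_zero d_lim)
    then have "\<forall>\<^sub>F k in sequentially. 2 * \<kappa> * d (s k) < e / 2"
      using \<open>e > 0\<close> by (intro order_tendstoD(2)) auto
    then obtain K where K: "2 * \<kappa> * d (s K) < e / 2"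
      by (auto simp: eventually_sequentially)
    show "\<exists>K. \<forall>m\<ge>K. \<forall>n\<ge>K. dist (s m) (s n) < e"
    proof (intro exI allI impI)
      fix m n assume "K \<le> m" "K \<le> n"
      then have "dist (s m) (s K) < e / 2" "dist (s n) (s K) < e / 2"
        using tail'[of K m] tail'[of K n] K by (auto simp: dist_norm)
      then show "dist (s m) (s n) < e" by (rule dist_triangle_half_l)
    qed
  qed
  then obtain l where l: "s \<longlonglongrightarrow> l" using Cauchy_convergent convergent_def by blast
  \<comment> \<open>The closed ball of half the radius retains the limit, so the Lipschitz estimate
    on the open ball also applies at \<open>l\<close>.\<close>
  have l_half: "l \<in> cball u0 (\<delta> / 2)" by (rule closed_sequentially[OF closed_cball in_half l])
  have err: "norm (s k - l) \<le> 2 * \<kappa> * d (s k)" for k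
  proof -
    have "(\<lambda>n. norm (s n - s k)) \<longlonglongrightarrow> norm (l - s k)" by (intro tendsto_intros l)
    then have "norm (l - s k) \<le> 2 * \<kappa> * d (s k)"
      by (rule tendsto_upperbound) (auto intro!: eventually_sequentiallyI[of k] tail')
    then show ?thesis by (simp add: norm_minus_commute)
  qed
  have "(\<lambda>k. N * norm (s k - l)) \<longlonglongrightarrow> 0"
    by (intro tendsto_mult_right_zero tendsto_norm_zero LIM_zero l)
  moreover have "\<forall>\<^sub>F k in sequentially. norm (d (s k) - d l) \<le> N * norm (s k - l)"
    unfolding real_norm_def by (intro always_eventually allI lip in_ball half l_half)
  ultimately have "(\<lambda>k. d (s k) - d l) \<longlonglongrightarrow> 0" by (rule Lim_null_comparison[rotated])
  then have "(\<lambda>k. d (s k)) \<longlonglongrightarrow> d l" by (simp add: LIM_zero_iff)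
  with d_lim have "d l = 0" by (rule LIMSEQ_unique[symmetric])
  with l l_half half in_ball err show ?thesis by blast
qed

section \<open>Maps with a uniform quadratic expansion\<close>

text \<open>The expansion, uniform in its base point, replaces a Lipschitz condition on the
  derivative. That \<open>J u\<close> is the derivative inside the ball is a consequence; outside
  it, \<open>J u\<close> is merely linear.\<close>

locale quadratic_approximation =
  fixes F :: "'a::euclidean_space \<Rightarrow> 'b::euclidean_space" and J :: "'a \<Rightarrow> 'a \<Rightarrow> 'b"
    and u0 :: 'a and R M :: real
  assumes linear_J: "linear (J u)"
    and R_pos: "R > 0" and M_nonneg: "M \<ge> 0"
    and approx: "u \<in> ball u0 R \<Longrightarrow> v \<in> ball u0 R \<Longrightarrow>
      norm (F v - F u - J u (v - u)) \<le> M * (norm (v - u))\<^sup>2"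
begin

text \<open>Three expansions, between the vertices of a triangle with two sides of equal length.\<close>

lemma derivative_close:
  assumes "2 * norm (u - u0) < R"
  shows "norm (J u h - J u0 h) \<le> 6 * M * norm (u - u0) * norm h"
proof (cases "h = 0 \<or> u = u0")
  case True
  then show ?thesis using linear_0[OF linear_J] by auto
next
  case False
  define \<rho> where "\<rho> = norm (u - u0)"
  \<comment> \<open>With \<open>h\<close> rescaled to length \<open>\<rho>\<close>, the three
    remainders are at most \<open>M\<close>, \<open>4 * M\<close> and \<open>M\<close> times the
    square of \<open>\<rho>\<close>, whence the factor 6. Linearity undoes the scaling.\<close>
  define w where "w = (\<rho> / norm h) *\<^sub>R h"
  have \<rho>: "\<rho> > 0" "norm w = \<rho>" using False by (auto simp: \<rho>_def w_def)
  have zw: "norm (u + w - u0) \<le> 2 * \<rho>"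
    using norm_triangle_ineq[of "u - u0" w] \<rho> by (simp add: \<rho>_def algebra_simps)
  have mem: "u \<in> ball u0 R" "u + w \<in> ball u0 R" "u0 \<in> ball u0 R"
    using assms zw R_pos \<rho>(1) by (auto simp: dist_norm norm_minus_commute \<rho>_def)
  define e1 e2 e3 where "e1 = F (u + w) - F u - J u w"
    and "e2 = F (u + w) - F u0 - J u0 (u + w - u0)" and "e3 = F u - F u0 - J u0 (u - u0)"
  have "norm e1 \<le> M * \<rho>\<^sup>2" using approx[OF mem(1,2)] \<rho> by (simp add: e1_def)
  moreover have "norm e2 \<le> M * (2 * \<rho>)\<^sup>2"
  proof -
    have "norm e2 \<le> M * (norm (u + w - u0))\<^sup>2" using approx[OF mem(3,2)] by (simp add: e2_def)
    also have "\<dots> \<le> M * (2 * \<rho>)\<^sup>2" using zw M_nonneg by (intro mult_left_mono power_mono) auto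
    finally show ?thesis .
  qed
  moreover have "norm e3 \<le> M * \<rho>\<^sup>2" using approx[OF mem(3,1)] by (simp add: e3_def \<rho>_def)
  moreover have "J u w - J u0 w = e2 - e1 - e3"
  proof -
    have "J u0 (u + w - u0) = J u0 w + J u0 (u - u0)"
      by (simp flip: linear_add[OF linear_J] add: algebra_simps)
    then show ?thesis by (simp add: e1_def e2_def e3_def)
  qed
  ultimately have "norm (J u w - J u0 w) \<le> 6 * M * \<rho>\<^sup>2"
    using norm_triangle_ineq4[of "e2 - e1" e3] norm_triangle_ineq4[of e2 e1]
    by (simp add: power_mult_distrib)
  moreover have "J u w - J u0 w = (\<rho> / norm h) *\<^sub>R (J u h - J u0 h)"
    by (simp add: w_def linear_scale[OF linear_J] scaleR_diff_right)
  ultimately have "\<rho> / norm h * norm (J u h - J u0 h) \<le> 6 * M * \<rho>\<^sup>2" using \<rho> by simp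
  then show ?thesis using False \<rho>(1) by (simp add: field_simps power2_eq_square \<rho>_def)
qed

text \<open>On the half ball \<open>J u\<close> differs from the bounded map \<open>J u0\<close> by
  at most \<open>3 * M * R\<close> in operator norm, and the remainder contributes one more
  \<open>M * R\<close> because two points are at most \<open>R\<close> apart.\<close>

lemma lipschitz_bounds:
  "\<exists>N>0. (\<forall>u\<in>ball u0 (R / 2). \<forall>h. norm (J u h) \<le> N * norm h) \<and>
         (\<forall>u\<in>ball u0 (R / 2). \<forall>v\<in>ball u0 (R / 2). norm (F v - F u) \<le> N * norm (v - u))"
proof -
  obtain B where B: "B > 0" "\<And>h. norm (J u0 h) \<le> B * norm h"
    using linear_bounded_pos[OF linear_J] by blast
  have J_bound: "norm (J u h) \<le> (B + 3 * M * R) * norm h" if "u \<in> ball u0 (R / 2)" for u h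
  proof -
    have u: "2 * norm (u - u0) < R" using that by (simp add: dist_norm norm_minus_commute)
    have "norm (J u h) \<le> norm (J u0 h) + norm (J u h - J u0 h)" by norm
    also have "\<dots> \<le> B * norm h + 3 * M * (2 * norm (u - u0)) * norm h"
      using B(2)[of h] derivative_close[OF u, of h] by simp
    also have "\<dots> \<le> B * norm h + 3 * M * R * norm h"
      using u M_nonneg by (intro add_left_mono mult_right_mono mult_left_mono) auto
    finally show ?thesis by (simp add: algebra_simps)
  qed
  have F_bound: "norm (F v - F u) \<le> (B + 4 * M * R) * norm (v - u)"
    if uv: "u \<in> ball u0 (R / 2)" "v \<in> ball u0 (R / 2)" for u v
  proof -
    have "norm (v - u) \<le> norm (v - u0) + norm (u - u0)" by norm
    then have small: "norm (v - u) \<le> R" using uv by (simp add: dist_norm norm_minus_commute)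
    have "norm (F v - F u) \<le> norm (J u (v - u)) + norm (F v - F u - J u (v - u))" by norm
    also have "\<dots> \<le> (B + 3 * M * R) * norm (v - u) + M * (norm (v - u))\<^sup>2"
      using uv R_pos by (intro add_mono J_bound approx) auto
    also have "\<dots> \<le> (B + 3 * M * R) * norm (v - u) + M * (R * norm (v - u))"
      using small M_nonneg by (intro add_left_mono mult_left_mono) (auto simp: power2_eq_square mult_right_mono)
    finally show ?thesis by (simp add: algebra_simps)
  qed
  show ?thesis
  proof (intro exI[of _ "B + 4 * M * R"] conjI ballI allI)
    show "B + 4 * M * R > 0" using B(1) M_nonneg R_pos by (simp add: add_pos_nonneg)
    fix u h assume "u \<in> ball u0 (R / 2)"
    then have "norm (J u h) \<le> (B + 3 * M * R) * norm h" by (rule J_bound)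
    also have "\<dots> \<le> (B + 4 * M * R) * norm h" using M_nonneg R_pos by (intro mult_right_mono) auto
    finally show "norm (J u h) \<le> (B + 4 * M * R) * norm h" .
  qed (rule F_bound)
qed

text \<open>The residual sets at \<open>u\<close> and \<open>u0\<close> differ by at most
  \<open>(6 * M + N) * norm (u - u0)\<close>. Close to \<open>u0\<close> this costs at most half of
  the radius \<open>\<eta>\<close>, so a ball of radius \<open>\<eta> / 2\<close> survives and
  \<open>\<kappa> = 2 / \<eta>\<close> serves for all such \<open>u\<close>.\<close>

lemma uniform_linearized_error_bound:
  assumes C: "closed C" "convex C" "F u0 \<in> C"
    and regular: "\<And>y. (\<And>h. y \<bullet> J u0 h = 0) \<Longrightarrow> y \<in> neg_polar ((\<lambda>c. c - F u0) ` C) \<Longrightarrow> y = 0"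
  shows "\<exists>\<kappa>>0. \<exists>\<delta>>0. \<forall>u\<in>ball u0 \<delta>. \<exists>h. F u + J u h \<in> C \<and> norm h \<le> \<kappa> * infdist (F u) C"
proof -
  define S where "S = C \<inter> cball (F u0) 1"
  have S: "compact S" "convex S" "S \<subseteq> C" "S \<noteq> {}"
    using C by (auto simp: S_def closed_Int_compact convex_Int)
  obtain \<eta> where \<eta>: "\<eta> > 0" "cball 0 \<eta> \<subseteq> residual_set (J u0) (F u0) S"
    unfolding S_def using cball_subset_residual_set[OF linear_J C regular] by metis
  obtain N where N: "N > 0"
    and lip: "\<And>u v. u \<in> ball u0 (R / 2) \<Longrightarrow> v \<in> ball u0 (R / 2) \<Longrightarrow> norm (F v - F u) \<le> N * norm (v - u)"
    using lipschitz_bounds by blast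
  define \<delta> where "\<delta> = min (R / 2) (\<eta> / (2 * (6 * M + N)))"
  have den: "6 * M + N > 0" using N M_nonneg by simp
  have "\<delta> > 0" using R_pos den \<eta>(1) by (simp add: \<delta>_def)
  moreover have "\<exists>h. F u + J u h \<in> C \<and> norm h \<le> 2 / \<eta> * infdist (F u) C" if u: "u \<in> ball u0 \<delta>" for u
  proof -
    have u': "norm (u - u0) < R / 2" "norm (u - u0) < \<eta> / (2 * (6 * M + N))"
      using u by (auto simp: \<delta>_def dist_norm norm_minus_commute)
    then have small: "(6 * M + N) * norm (u - u0) \<le> \<eta> / 2" using den by (simp add: field_simps)
    have "\<exists>k'\<in>residual_set (J u) (F u) S. norm (k' - k) \<le> \<eta> / 2"
      if "k \<in> residual_set (J u0) (F u0) S" for k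
    proof -
      from that obtain h s where hs: "k = J u0 h - (s - F u0)" "norm h \<le> 1" "s \<in> S"
        by (auto simp: residual_set_def)
      have "J u h - (s - F u) - k = (J u h - J u0 h) + (F u - F u0)" by (simp add: hs)
      then have "norm (J u h - (s - F u) - k) \<le> norm (J u h - J u0 h) + norm (F u - F u0)"
        by (metis norm_triangle_ineq)
      also have "\<dots> \<le> 6 * M * norm (u - u0) * norm h + N * norm (u - u0)"
        using u' R_pos by (intro add_mono derivative_close lip) (auto simp: dist_norm norm_minus_commute)
      also have "\<dots> \<le> 6 * M * norm (u - u0) * 1 + N * norm (u - u0)"
        using hs M_nonneg by (intro add_right_mono mult_left_mono) auto
      also have "\<dots> \<le> \<eta> / 2" using small by (simp add: algebra_simps)
      finally show ?thesis
        using hs by (intro bexI[of _ "J u h - (s - F u)"]) (auto simp: residual_set_def)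
    qed
    then have "cball 0 (\<eta> - \<eta> / 2) \<subseteq> residual_set (J u) (F u) S"
      using \<eta> S linear_J
      by (intro cball_subset_perturb[OF \<eta>(2)] convex_residual_set compact_imp_closed compact_residual_set) auto
    from solvability_of_cball_subset[OF linear_J C(1,2) S(3,4) this] \<eta>(1)
    show ?thesis by (simp add: mult.commute)
  qed
  ultimately show ?thesis using \<eta>(1) by (intro exI[of _ "2 / \<eta>"] conjI exI[of _ \<delta>]) auto
qed

end

section \<open>Local convergence of the linearized proximal algorithm\<close>

text \<open>The smallness conditions on the radius in the convergence proof have this form, so one
  radius can satisfy all of them.\<close>

lemma eventually_at_right_0_mult_le:
  fixes a c :: real
  assumes "a > 0"
  shows "\<forall>\<^sub>F \<delta> in at_right 0. c * \<delta> \<le> a"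
proof -
  have "((\<lambda>\<delta>. c * \<delta>) \<longlongrightarrow> c * 0) (at_right 0)" by (intro tendsto_intros)
  then have "\<forall>\<^sub>F \<delta> in at_right 0. c * \<delta> < a" using assms by (intro order_tendstoD(2)) auto
  then show ?thesis by eventually_elim simp
qed

text \<open>The vector \<open>h\<close> is a competitor whose linearized value is already minimal
  for \<open>L\<close>. Optimality of \<open>\<Delta>\<close> thus bounds the excess of
  \<open>L\<close> plus the proximal term by the proximal term of \<open>h\<close>: dropping the
  excess gives the first bound, dropping the term of \<open>\<Delta>\<close> and using sharpness the
  second.\<close>

lemma lpa_step_bounds:
  fixes F :: "real ^ 'n \<Rightarrow> real ^ 'm" and L :: "real ^ 'm \<Rightarrow> real"
  defines "C \<equiv> minimizers L" and "J \<equiv> \<lambda>u h. jacobian F (at u) *v h"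
  assumes arg_min: "is_arg_min (lpa_objective F L t u) (\<lambda>_. True) \<Delta>"
    and t: "t > 0" and \<beta>: "\<beta> > 0" and \<alpha>: "\<alpha> > 0" and \<eta>: "\<eta> \<ge> 0"
    and t_large: "\<kappa>\<^sup>2 \<le> 2 * t * \<alpha> * \<eta> powr \<beta>"
    and h: "F u + J u h \<in> C" "norm h \<le> \<kappa> * infdist (F u) C" and \<kappa>: "\<kappa> \<ge> 0"
    and sharp: "\<And>z. z \<in> S \<Longrightarrow> L z \<ge> (INF w. L w) + \<alpha> * infdist z C powr \<beta>"
    and in_S: "norm \<Delta> \<le> \<kappa> * infdist (F u) C \<Longrightarrow> F u + J u \<Delta> \<in> S"
  shows "norm \<Delta> \<le> \<kappa> * infdist (F u) C"
    and "infdist (F u + J u \<Delta>) C \<le> \<eta> * infdist (F u) C powr (2 / \<beta>)"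
proof -
  define d where "d = infdist (F u) C"
  define z where "z = F u + J u \<Delta>"
  have d0: "d \<ge> 0" by (simp add: d_def infdist_nonneg)
  have min: "L (F u + J u h) \<le> L w" for w using h(1) by (auto simp: C_def minimizers_iff)
  have INF: "(INF w. L w) = L (F u + J u h)"
    using h(1) unfolding C_def by (rule INF_eq_minimum)
  have "L z + 1 / (2 * t) * (norm \<Delta>)\<^sup>2 \<le> L (F u + J u h) + 1 / (2 * t) * (norm h)\<^sup>2"
    using arg_min by (auto simp: is_arg_min_linorder lpa_objective_def z_def J_def)
  moreover have "(norm h)\<^sup>2 \<le> (\<kappa> * d)\<^sup>2" using h(2) by (intro power_mono) (auto simp: d_def)
  then have "1 / (2 * t) * (norm h)\<^sup>2 \<le> 1 / (2 * t) * (\<kappa> * d)\<^sup>2"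
    using t by (intro mult_left_mono) auto
  ultimately have key: "L z - (INF w. L w) + 1 / (2 * t) * (norm \<Delta>)\<^sup>2 \<le> 1 / (2 * t) * (\<kappa> * d)\<^sup>2"
    unfolding INF by linarith
  then have "1 / (2 * t) * (norm \<Delta>)\<^sup>2 \<le> 1 / (2 * t) * (\<kappa> * d)\<^sup>2"
    using min[of z] unfolding INF by linarith
  then have "(norm \<Delta>)\<^sup>2 \<le> (\<kappa> * d)\<^sup>2" using t by (simp add: field_simps)
  then have step: "norm \<Delta> \<le> \<kappa> * d" using \<kappa> d0 by (auto intro: power2_le_imp_le)
  then show "norm \<Delta> \<le> \<kappa> * infdist (F u) C" by (simp add: d_def)
  \<comment> \<open>Sharpness is only local; the step bound just obtained places \<open>z\<close> in
    its domain.\<close>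
  have "z \<in> S" unfolding z_def using step by (intro in_S) (simp add: d_def)
  then have "\<alpha> * infdist z C powr \<beta> \<le> L z - (INF w. L w)" using sharp[of z] by simp
  also have "\<dots> \<le> 1 / (2 * t) * (\<kappa> * d)\<^sup>2"
  proof -
    have "1 / (2 * t) * (norm \<Delta>)\<^sup>2 \<ge> 0" using t by simp
    with key show ?thesis by linarith
  qed
  also have "\<dots> = \<kappa>\<^sup>2 * d\<^sup>2 / (2 * t)" by (simp add: power_mult_distrib)
  also have "\<dots> \<le> (2 * t * \<alpha> * \<eta> powr \<beta>) * d\<^sup>2 / (2 * t)"
    using t by (intro divide_right_mono mult_right_mono t_large) auto
  also have "\<dots> = \<alpha> * (\<eta> * d powr (2 / \<beta>)) powr \<beta>"
  proof -
    have "(d powr (2 / \<beta>)) powr \<beta> = d\<^sup>2" using \<beta> d0 by (simp add: powr_powr)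
    then show ?thesis using t \<eta> by (simp add: powr_mult)
  qed
  finally have "infdist z C powr \<beta> \<le> (\<eta> * d powr (2 / \<beta>)) powr \<beta>" using \<alpha> by simp
  then have "infdist z C \<le> \<eta> * d powr (2 / \<beta>)"
    using powr_less_mono2[OF \<beta>, of "\<eta> * d powr (2 / \<beta>)" "infdist z C"] \<eta> by fastforce
  then show "infdist (F u + J u \<Delta>) C \<le> \<eta> * infdist (F u) C powr (2 / \<beta>)"
    by (simp add: z_def d_def)
qed

theorem lpa_local_convergence:
  fixes F :: "real ^ 'n \<Rightarrow> real ^ 'm" and L :: "real ^ 'm \<Rightarrow> real"
  assumes quad: "quadratic_approximation F (\<lambda>u h. jacobian F (at u) *v h) u0 R M"
    and closed_C: "closed (minimizers L)" and convex_C: "convex (minimizers L)"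
    and \<beta>: "1 \<le> \<beta>" "\<beta> \<le> 2" and "r > 0"
    and u0: "F u0 \<in> minimizers L"
    and sharp: "weak_sharp_minima \<beta> L (ball (F u0) r)"
    and regular: "regular_point F (minimizers L) u0"
  shows "\<exists>t0\<ge>0. \<exists>rbar>0. \<forall>t>t0. \<forall>\<theta>0\<in>ball u0 rbar. \<forall>\<theta>.
           lpa_sequence F L t \<theta>0 \<theta> \<longrightarrow>
           (\<exists>l. converges_at_rate \<theta> l (2 / \<beta>) \<and> F l \<in> minimizers L)"
proof -
  define C where "C = minimizers L"
  define J where "J = (\<lambda>u h. jacobian F (at u) *v h)"
  interpret quadratic_approximation F J u0 R M unfolding J_def by (rule quad)
  define d where "d = (\<lambda>u. infdist (F u) C)"
  define p where "p = 2 / \<beta>"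
  have C: "closed C" "convex C" "F u0 \<in> C" using closed_C convex_C u0 by (auto simp: C_def)
  have p: "1 \<le> p" "p \<le> 2" using \<beta> by (auto simp: p_def field_simps)
  obtain \<alpha> where \<alpha>: "\<alpha> > 0"
    and sharp': "\<And>z. z \<in> ball (F u0) r \<Longrightarrow> L z \<ge> (INF w. L w) + \<alpha> * infdist z C powr \<beta>"
    using sharp by (auto simp: weak_sharp_minima_def C_def)
  \<comment> \<open>The kernel of the transposed Jacobian is the orthogonal complement of the range
    of \<open>J u0\<close>.\<close>
  have "y = 0" if orth: "\<And>h. y \<bullet> J u0 h = 0" and "y \<in> neg_polar ((\<lambda>c. c - F u0) ` C)" for y
  proof -
    have "(transpose (jacobian F (at u0)) *v y) \<bullet> h = 0" for h
      using orth[of h] by (simp add: J_def dot_lmul_matrix flip: vector_transpose_matrix)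
    then have "transpose (jacobian F (at u0)) *v y = 0" by (metis inner_eq_zero_iff)
    with that(2) regular show "y = 0" by (auto simp: regular_point_def C_def)
  qed
  from uniform_linearized_error_bound[OF C this] obtain \<kappa> \<delta>1 where \<kappa>: "\<kappa> > 0" and "\<delta>1 > 0"
    and solve: "\<And>u. u \<in> ball u0 \<delta>1 \<Longrightarrow> \<exists>h. F u + J u h \<in> C \<and> norm h \<le> \<kappa> * d u"
    unfolding d_def by metis
  obtain N where N: "N > 0"
    and J_bound: "\<And>u h. u \<in> ball u0 (R / 2) \<Longrightarrow> norm (J u h) \<le> N * norm h"
    and F_lip: "\<And>u v. u \<in> ball u0 (R / 2) \<Longrightarrow> v \<in> ball u0 (R / 2) \<Longrightarrow> norm (F v - F u) \<le> N * norm (v - u)"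
    using lipschitz_bounds by blast
  \<comment> \<open>The bound \<open>1 / 4\<close> makes the error halve, as
    \<open>2 * \<eta> \<le> 1 / 2\<close>. The other bound yields a contraction factor
    \<open>4 * (\<kappa> * N * \<eta>) \<le> 1 / 2\<close> for the iterates in the linear
    case.\<close>
  define \<eta> where "\<eta> = min (1 / 4) (1 / (8 * \<kappa> * N))"
  have \<eta>: "\<eta> > 0" "\<eta> \<le> 1 / 4" "\<kappa> * N * \<eta> \<le> 1 / 8"
    using \<kappa> N by (auto simp: \<eta>_def min_def field_simps)
  define t0 where "t0 = \<kappa>\<^sup>2 / (2 * \<alpha> * \<eta> powr \<beta>)"
  have "t0 \<ge> 0" using \<alpha> by (simp add: t0_def)
  \<comment> \<open>In order: linearized inclusions are solvable, the next iterate stays in the half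
    ball, \<open>d \<le> 1\<close>, linearized values stay where sharpness holds, and the quadratic
    error is at most \<open>\<eta> * d\<close>.\<close>
  have "\<forall>\<^sub>F \<delta> in at_right 0. 0 < \<delta> \<and> 1 * \<delta> \<le> \<delta>1 \<and> (1 + \<kappa> * N) * \<delta> \<le> R / 2 \<and> N * \<delta> \<le> 1 \<and>
      (N * (1 + \<kappa> * N)) * \<delta> \<le> r \<and> (M * \<kappa>\<^sup>2 * N) * \<delta> \<le> \<eta>"
    using \<open>\<delta>1 > 0\<close> R_pos \<open>r > 0\<close> \<eta>(1)
    by (intro eventually_conj eventually_at_right_0_mult_le eventually_at_right_less) simp_all
  from eventually_happens'[OF trivial_limit_at_right_real this]
  obtain \<delta> where \<delta>: "0 < \<delta>" "\<delta> \<le> \<delta>1" "(1 + \<kappa> * N) * \<delta> \<le> R / 2" "N * \<delta> \<le> 1"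
      "(N * (1 + \<kappa> * N)) * \<delta> \<le> r" "(M * \<kappa>\<^sup>2 * N) * \<delta> \<le> \<eta>"
    unfolding mult_1 by blast
  have ball_half: "u \<in> ball u0 (R / 2)" if "u \<in> ball u0 \<delta>" for u
  proof -
    have "\<delta> \<le> (1 + \<kappa> * N) * \<delta>" using \<delta>(1) \<kappa> N by simp
    then show ?thesis using that \<delta>(3) by simp
  qed
  have d_nonneg: "d u \<ge> 0" for u by (simp add: d_def infdist_nonneg)
  have d_u0: "d u0 = 0" using C by (simp add: d_def)
  have d_lip: "\<bar>d u - d v\<bar> \<le> N * norm (u - v)" if "u \<in> ball u0 \<delta>" "v \<in> ball u0 \<delta>" for u v
    using infdist_triangle_abs[of "F u" C "F v"] F_lip[OF ball_half[OF that(2)] ball_half[OF that(1)]]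
    by (simp add: d_def dist_norm)
  define A where "A = \<eta> + M * \<kappa>\<^sup>2"
  have "A \<ge> 0" using \<eta> M_nonneg by (simp add: A_def)
  have step: "norm \<Delta> \<le> \<kappa> * d u \<and> d (u + \<Delta>) \<le> A * d u powr p \<and> d (u + \<Delta>) \<le> 2 * \<eta> * d u"
    if u: "u \<in> ball u0 \<delta>" and t: "t > t0" and \<Delta>: "is_arg_min (lpa_objective F L t u) (\<lambda>_. True) \<Delta>" for u t \<Delta>
  proof -
    have ru: "norm (u - u0) < \<delta>" using u by (simp add: dist_norm norm_minus_commute)
    have d_le: "d u \<le> N * norm (u - u0)" using d_lip[OF u, of u0] d_u0 \<delta>(1) by simp
    have "N * norm (u - u0) \<le> N * \<delta>" using N ru by simp
    with d_le have d_le': "d u \<le> N * \<delta>" by linarith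
    then have d_le_1: "d u \<le> 1" using \<delta>(4) by linarith
    have "u \<in> ball u0 \<delta>1" using u \<delta>(2) by simp
    then obtain h where h: "F u + J u h \<in> C" "norm h \<le> \<kappa> * d u" using solve by blast
    have in_ball: "F u + J u v \<in> ball (F u0) r" if v: "norm v \<le> \<kappa> * d u" for v
    proof -
      have "norm (F u + J u v - F u0) \<le> norm (F u - F u0) + norm (J u v)" by norm
      also have "\<dots> \<le> N * norm (u - u0) + N * norm v"
        using u \<delta>(1) by (intro add_mono F_lip J_bound ball_half) auto
      also have "\<dots> \<le> N * norm (u - u0) + N * (\<kappa> * (N * \<delta>))"
      proof -
        have "\<kappa> * d u \<le> \<kappa> * (N * \<delta>)" using \<kappa> d_le' by simp
        then have "norm v \<le> \<kappa> * (N * \<delta>)" using v by linarith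
        then show ?thesis using N by simp
      qed
      also have "\<dots> < N * \<delta> + N * (\<kappa> * (N * \<delta>))" using N ru by simp
      also have "\<dots> \<le> r" using \<delta>(5) by (simp add: algebra_simps)
      finally show ?thesis by (simp add: dist_norm norm_minus_commute)
    qed
    have "t > 0" using \<open>t0 \<ge> 0\<close> t by simp
    moreover have "\<kappa>\<^sup>2 \<le> 2 * t * \<alpha> * \<eta> powr \<beta>"
      using t \<alpha> \<eta>(1) by (simp add: t0_def field_simps)
    ultimately have bounds: "norm \<Delta> \<le> \<kappa> * d u" "infdist (F u + J u \<Delta>) C \<le> \<eta> * d u powr p"
      using lpa_step_bounds[OF \<Delta>, of \<beta> \<alpha> \<eta> \<kappa> h "ball (F u0) r"] \<beta>(1) \<alpha> \<eta>(1) \<kappa> h sharp' in_ball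
      unfolding d_def p_def C_def J_def by auto
    have "u + \<Delta> \<in> ball u0 (R / 2)"
    proof -
      have "norm (u + \<Delta> - u0) \<le> norm (u - u0) + norm \<Delta>" by norm
      also have "\<dots> < \<delta> + \<kappa> * (N * \<delta>)"
      proof -
        have "\<kappa> * d u \<le> \<kappa> * (N * \<delta>)" using \<kappa> d_le' by simp
        then show ?thesis using ru bounds(1) by linarith
      qed
      also have "\<dots> \<le> R / 2" using \<delta>(3) by (simp add: algebra_simps)
      finally show ?thesis by (simp add: dist_norm norm_minus_commute)
    qed
    then have "norm (F (u + \<Delta>) - F u - J u \<Delta>) \<le> M * (norm \<Delta>)\<^sup>2"
      using approx[of u "u + \<Delta>"] ball_half[OF u] R_pos by simp
    also have "\<dots> \<le> M * (\<kappa> * d u)\<^sup>2"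
      using bounds(1) M_nonneg by (intro mult_left_mono power_mono) auto
    finally have "dist (F (u + \<Delta>)) (F u + J u \<Delta>) \<le> M * \<kappa>\<^sup>2 * (d u)\<^sup>2"
      by (simp add: dist_norm power_mult_distrib algebra_simps)
    then have main: "d (u + \<Delta>) \<le> \<eta> * d u powr p + M * \<kappa>\<^sup>2 * (d u)\<^sup>2"
      using infdist_triangle[of "F (u + \<Delta>)" C "F u + J u \<Delta>"] bounds(2) unfolding d_def by linarith
    \<comment> \<open>As \<open>d u \<le> 1\<close> and \<open>1 \<le> p \<le> 2\<close>, the three
      powers are ordered. The first inequality absorbs the linearization error into order
      \<open>p\<close>, the second gives the linear decay.\<close>
    have sq_le: "(d u)\<^sup>2 \<le> d u powr p" and powr_le: "d u powr p \<le> d u"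
      using powr_mono'[OF p(2) d_nonneg d_le_1] powr_mono'[OF p(1) d_nonneg d_le_1] d_nonneg[of u]
      by auto
    have "d (u + \<Delta>) \<le> A * d u powr p"
    proof -
      have "M * \<kappa>\<^sup>2 * (d u)\<^sup>2 \<le> M * \<kappa>\<^sup>2 * d u powr p"
        using sq_le M_nonneg by (intro mult_left_mono) auto
      then show ?thesis using main by (simp add: A_def algebra_simps)
    qed
    moreover have "d (u + \<Delta>) \<le> 2 * \<eta> * d u"
    proof -
      have "M * \<kappa>\<^sup>2 * d u \<le> M * \<kappa>\<^sup>2 * (N * \<delta>)" using d_le' M_nonneg by (intro mult_left_mono) auto
      then have "M * \<kappa>\<^sup>2 * d u \<le> \<eta>" using \<delta>(6) by (simp add: algebra_simps)
      then have "M * \<kappa>\<^sup>2 * d u * d u \<le> \<eta> * d u" using d_nonneg by (intro mult_right_mono) auto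
      moreover have "\<eta> * d u powr p \<le> \<eta> * d u" using powr_le \<eta>(1) by simp
      ultimately show ?thesis using main by (simp add: power2_eq_square algebra_simps)
    qed
    ultimately show ?thesis using bounds(1) by blast
  qed
  define rbar where "rbar = \<delta> / (2 * (1 + 2 * \<kappa> * N))"
  have "rbar > 0" using \<delta>(1) \<kappa> N by (simp add: rbar_def add_pos_pos)
  moreover have "\<exists>l. converges_at_rate \<theta> l (2 / \<beta>) \<and> F l \<in> minimizers L"
    if t: "t > t0" and \<theta>0: "\<theta>0 \<in> ball u0 rbar" and \<theta>: "lpa_sequence F L t \<theta>0 \<theta>" for t \<theta>0 \<theta>
  proof -
    have seq: "norm (\<theta> (Suc k) - \<theta> k) \<le> \<kappa> * d (\<theta> k) \<and> d (\<theta> (Suc k)) \<le> A * d (\<theta> k) powr p \<and>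
        d (\<theta> (Suc k)) \<le> 2 * \<eta> * d (\<theta> k)" if k: "\<theta> k \<in> ball u0 \<delta>" for k
    proof -
      obtain \<Delta> where "is_arg_min (lpa_objective F L t (\<theta> k)) (\<lambda>_. True) \<Delta>" "\<theta> (Suc k) = \<theta> k + \<Delta>"
        using \<theta> by (auto simp: lpa_sequence_def)
      then show ?thesis using step[OF k t, of \<Delta>] by simp
    qed
    have "norm (\<theta> (Suc k) - \<theta> k) \<le> \<kappa> * d (\<theta> k) \<and> d (\<theta> (Suc k)) \<le> d (\<theta> k) / 2"
      if "\<theta> k \<in> ball u0 \<delta>" for k
      using seq[OF that] mult_right_mono[OF \<eta>(2) d_nonneg[of "\<theta> k"]] by simp
    moreover have "\<theta> 0 \<in> ball u0 (\<delta> / (2 * (1 + 2 * \<kappa> * N)))"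
      using \<theta> \<theta>0 by (simp add: lpa_sequence_def rbar_def)
    ultimately obtain l where l: "l \<in> ball u0 \<delta>" "\<theta> \<longlonglongrightarrow> l" "d l = 0"
      and tail: "\<And>k. \<theta> k \<in> ball u0 \<delta>" "\<And>k. norm (\<theta> k - l) \<le> 2 * \<kappa> * d (\<theta> k)"
      using geometric_error_convergence[of d u0 \<delta> N \<kappa> \<theta>] d_nonneg d_u0 d_lip \<kappa> N \<delta>(1) by metis
    \<comment> \<open>Together with \<open>tail\<close> this makes \<open>d (\<theta> k)\<close>
      comparable to the distance from the limit, so decay of \<open>d\<close> transfers to the
      iterates.\<close>
    have d_le: "d (\<theta> k) \<le> N * norm (\<theta> k - l)" for k
      using d_lip[OF tail(1)[of k] l(1)] l(3) by simp
    have "converges_at_rate \<theta> l p"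
    \<comment> \<open>Order 1 demands a factor below 1, supplied by the bound with
      \<open>2 * \<eta>\<close>; for larger orders any constant will do, and the bound with
      \<open>A\<close> is used.\<close>
    proof (cases "p = 1")
      case True
      have "norm (\<theta> (Suc k) - l) \<le> 1 / 2 * norm (\<theta> k - l) powr p" for k
      proof -
        have "norm (\<theta> (Suc k) - l) \<le> 2 * \<kappa> * d (\<theta> (Suc k))" by (rule tail(2))
        also have "\<dots> \<le> 2 * \<kappa> * (2 * \<eta> * (N * norm (\<theta> k - l)))"
        proof -
          have "2 * \<eta> * d (\<theta> k) \<le> 2 * \<eta> * (N * norm (\<theta> k - l))"
            using d_le \<eta>(1) by (intro mult_left_mono) auto
          then show ?thesis using seq[OF tail(1)[of k]] \<kappa> by (intro mult_left_mono) auto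
        qed
        also have "\<dots> = 4 * (\<kappa> * N * \<eta>) * norm (\<theta> k - l)" by simp
        also have "\<dots> \<le> 4 * (1 / 8) * norm (\<theta> k - l)"
          using \<eta>(3) by (intro mult_right_mono mult_left_mono) auto
        finally show ?thesis using True by simp
      qed
      then show ?thesis
        unfolding converges_at_rate_def using l(2) by (intro conjI exI[of _ "1 / 2"]) auto
    next
      case False
      have "norm (\<theta> (Suc k) - l) \<le> (2 * \<kappa> * A * N powr p) * norm (\<theta> k - l) powr p" for k
      proof -
        have "norm (\<theta> (Suc k) - l) \<le> 2 * \<kappa> * d (\<theta> (Suc k))" by (rule tail(2))
        also have "\<dots> \<le> 2 * \<kappa> * (A * (N * norm (\<theta> k - l)) powr p)"
        proof -
          have "A * d (\<theta> k) powr p \<le> A * (N * norm (\<theta> k - l)) powr p"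
            using d_le d_nonneg p \<open>A \<ge> 0\<close> by (intro mult_left_mono powr_mono2) auto
          then show ?thesis using seq[OF tail(1)[of k]] \<kappa> by (intro mult_left_mono) auto
        qed
        finally show ?thesis using N by (simp add: powr_mult algebra_simps)
      qed
      then show ?thesis
        unfolding converges_at_rate_def using l(2) False
        by (intro conjI exI[of _ "2 * \<kappa> * A * N powr p"]) auto
    qed
    moreover have "F l \<in> C"
      using l(3) C in_closed_iff_infdist_zero[OF C(1), of "F l"] by (auto simp: d_def)
    ultimately show ?thesis unfolding p_def C_def by blast
  qed
  ultimately show ?thesis using \<open>t0 \<ge> 0\<close> by blast
qed

section \<open>Sigmoid networks\<close>

context quadratic_approximation
begin

lemma has_derivative_J:
  assumes "u \<in> ball u0 R"
  shows "(F has_derivative J u) (at u)"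
proof -
  obtain e where e: "e > 0" "ball u e \<subseteq> ball u0 R"
    using assms open_ball openE by blast
  show ?thesis
  proof (rule has_derivativeI_sandwich[OF e(1)])
    show "bounded_linear (J u)" using linear_J by (simp add: linear_linear)
    have "((\<lambda>v. M * norm (v - u)) \<longlongrightarrow> M * norm (u - u)) (at u)" by (intro tendsto_intros)
    then show "((\<lambda>v. M * norm (v - u)) \<longlongrightarrow> 0) (at u)" by simp
    fix v assume v: "v \<noteq> u" "dist v u < e"
    then have "norm (F v - F u - J u (v - u)) \<le> M * (norm (v - u))\<^sup>2"
      using e(2) assms by (intro approx) (auto simp: subset_iff dist_commute)
    then show "norm (F v - F u - J u (v - u)) / norm (v - u) \<le> M * norm (v - u)"
      using v by (simp add: divide_le_eq power2_eq_square mult.assoc)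
  qed
qed

end

text \<open>Uniqueness of derivatives identifies \<open>J u\<close> with the Jacobian inside the
  ball. Elsewhere only linearity is required, which every matrix provides.\<close>

lemma quadratic_approximation_jacobian:
  fixes F :: "real ^ 'n \<Rightarrow> real ^ 'm"
  assumes "quadratic_approximation F J u0 R M"
  shows "quadratic_approximation F (\<lambda>u h. jacobian F (at u) *v h) u0 R M"
proof -
  interpret quadratic_approximation F J u0 R M by fact
  have "(\<lambda>h. jacobian F (at u) *v h) = J u" if "u \<in> ball u0 R" for u
    using has_derivative_J[OF that] by (metis differentiableI has_derivative_unique jacobian_works)
  then have "jacobian F (at u) *v h = J u h" if "u \<in> ball u0 R" for u h
    using that by metis
  then show ?thesis
    using R_pos M_nonneg approx by unfold_locales (simp_all add: matrix_vector_right_distrib matrix_vector_mult_scaleR)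
qed

section \<open>Closure properties of quadratic approximability\<close>

text \<open>The radius is fixed at \<open>1\<close> so that expansions of different functions hold
  on one ball and combine without shrinking it.\<close>

definition quadratically_approximable ::
    "('a::euclidean_space \<Rightarrow> 'b::euclidean_space) \<Rightarrow> 'a \<Rightarrow> bool" where
  "quadratically_approximable f u0 \<longleftrightarrow> (\<exists>J M. quadratic_approximation f J u0 1 M)"

lemma quadratically_approximableI:
  assumes "\<And>u. linear (J u)" "M \<ge> 0"
    and "\<And>u v. u \<in> ball u0 1 \<Longrightarrow> v \<in> ball u0 1 \<Longrightarrow>
      norm (f v - f u - J u (v - u)) \<le> M * (norm (v - u))\<^sup>2"
  shows "quadratically_approximable f u0"
  unfolding quadratically_approximable_def quadratic_approximation_def using assms by fastforce

lemma quadratically_approximable_linear: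
  assumes "linear f"
  shows "quadratically_approximable f u0"
  by (rule quadratically_approximableI[of "\<lambda>_. f" 0]) (simp_all add: assms linear_diff)

lemma quadratically_approximable_const: "quadratically_approximable (\<lambda>_. c) u0"
  by (rule quadratically_approximableI[of "\<lambda>_ _. 0" 0]) (auto intro: linearI)

lemma quadratically_approximable_add:
  assumes "quadratically_approximable f u0" "quadratically_approximable g u0"
  shows "quadratically_approximable (\<lambda>u. f u + g u) u0"
proof -
  obtain J1 M1 J2 M2 where
    f: "quadratic_approximation f J1 u0 1 M1" and g: "quadratic_approximation g J2 u0 1 M2"
    using assms by (auto simp: quadratically_approximable_def)
  interpret f: quadratic_approximation f J1 u0 1 M1 by (rule f)
  interpret g: quadratic_approximation g J2 u0 1 M2 by (rule g)
  show ?thesis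
  proof (rule quadratically_approximableI[of "\<lambda>u h. J1 u h + J2 u h" "M1 + M2"])
    fix u v assume uv: "u \<in> ball u0 1" "v \<in> ball u0 1"
    have "f v + g v - (f u + g u) - (J1 u (v - u) + J2 u (v - u)) =
        (f v - f u - J1 u (v - u)) + (g v - g u - J2 u (v - u))" by simp
    then show "norm (f v + g v - (f u + g u) - (J1 u (v - u) + J2 u (v - u))) \<le>
        (M1 + M2) * (norm (v - u))\<^sup>2"
      unfolding distrib_right
      using norm_triangle_le[OF add_mono[OF f.approx[OF uv] g.approx[OF uv]]] by metis
  qed (use f.M_nonneg g.M_nonneg linear_compose_add[OF f.linear_J g.linear_J] in auto)
qed

lemma quadratically_approximable_sum:
  assumes "finite I" "\<And>i. i \<in> I \<Longrightarrow> quadratically_approximable (f i) u0"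
  shows "quadratically_approximable (\<lambda>u. \<Sum>i\<in>I. f i u) u0"
  using assms
  by (induction I rule: finite_induct)
    (simp_all add: quadratically_approximable_const quadratically_approximable_add)

lemma quadratically_approximable_linear_compose:
  assumes "quadratically_approximable f u0" and g: "linear g"
  shows "quadratically_approximable (\<lambda>u. g (f u)) u0"
proof -
  obtain J M where "quadratic_approximation f J u0 1 M"
    using assms(1) by (auto simp: quadratically_approximable_def)
  then interpret quadratic_approximation f J u0 1 M .
  obtain B where B: "B > 0" "\<And>z. norm (g z) \<le> B * norm z" using linear_bounded_pos[OF g] by blast
  show ?thesis
  proof (rule quadratically_approximableI[of "\<lambda>u h. g (J u h)" "B * M"])
    fix u v assume uv: "u \<in> ball u0 1" "v \<in> ball u0 1"
    have "norm (g (f v - f u - J u (v - u))) \<le> B * norm (f v - f u - J u (v - u))" by (rule B)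
    also have "\<dots> \<le> B * (M * (norm (v - u))\<^sup>2)" using B(1) approx[OF uv] by simp
    finally show "norm (g (f v) - g (f u) - g (J u (v - u))) \<le> B * M * (norm (v - u))\<^sup>2"
      by (simp add: linear_diff[OF g])
  qed (use B(1) M_nonneg linear_compose[OF linear_J g] in \<open>auto simp: o_def\<close>)
qed

text \<open>Expanding in the standard basis reduces this to sums and linear images.\<close>

lemma quadratically_approximable_vec_lambda:
  fixes f :: "'m::finite \<Rightarrow> 'a::euclidean_space \<Rightarrow> real"
  assumes "\<And>i. quadratically_approximable (f i) u0"
  shows "quadratically_approximable (\<lambda>u. \<chi> i. f i u) u0"
proof -
  have "linear (\<lambda>c. c *\<^sub>R axis i (1 :: real) :: real ^ 'm)" for i
    by (intro linearI) (simp_all add: algebra_simps)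
  then have "quadratically_approximable (\<lambda>u. f i u *\<^sub>R axis i (1 :: real) :: real ^ 'm) u0" for i
    by (rule quadratically_approximable_linear_compose[OF assms])
  then have "quadratically_approximable (\<lambda>u. \<Sum>i\<in>UNIV. f i u *\<^sub>R axis i (1 :: real) :: real ^ 'm) u0"
    by (intro quadratically_approximable_sum) auto
  moreover have "(\<lambda>u. \<Sum>i\<in>UNIV. f i u *\<^sub>R axis i (1 :: real)) = (\<lambda>u. \<chi> i. f i u)"
    by (auto simp: fun_eq_iff vec_eq_iff axis_def if_distrib cong: if_cong)
  ultimately show ?thesis by simp
qed

section \<open>Quadratic expansion of the network\<close>

lemma sigmoid_bounds: "0 < sigmoid a" "sigmoid a < 1"
  by (auto simp: sigmoid_def add_pos_pos)

lemma has_real_derivative_sigmoid: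
  "(sigmoid has_real_derivative sigmoid a * (1 - sigmoid a)) (at a)"
proof -
  define e where "e = exp (- a)"
  have nz: "1 + e \<noteq> 0" using exp_gt_zero[of "- a"] unfolding e_def by linarith
  have "((\<lambda>a. 1 / (1 + exp (- a))) has_real_derivative e / (1 + e)\<^sup>2) (at a)"
    using nz unfolding e_def
    by (auto intro!: derivative_eq_intros simp: power2_eq_square)
  moreover have "e / (1 + e)\<^sup>2 = 1 / (1 + e) * (1 - 1 / (1 + e))"
    using nz by (simp add: divide_simps power2_eq_square)
  ultimately show ?thesis unfolding sigmoid_def[abs_def] e_def by simp
qed

lemma sigmoid_mean_value:
  "\<exists>c. \<bar>c - a\<bar> \<le> \<bar>b - a\<bar> \<and> sigmoid b - sigmoid a = (b - a) * (sigmoid c * (1 - sigmoid c))"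
proof (cases a b rule: linorder_cases)
  case less
  from MVT2[OF less has_real_derivative_sigmoid] obtain c where
    "a < c" "c < b" "sigmoid b - sigmoid a = (b - a) * (sigmoid c * (1 - sigmoid c))" by blast
  then show ?thesis by (intro exI[of _ c] conjI) simp_all
next
  case greater
  from MVT2[OF greater has_real_derivative_sigmoid] obtain c where
    "b < c" "c < a" "sigmoid a - sigmoid b = (a - b) * (sigmoid c * (1 - sigmoid c))" by blast
  moreover from this(3) have "sigmoid b - sigmoid a = (b - a) * (sigmoid c * (1 - sigmoid c))"
    by (metis minus_diff_eq mult_minus_left)
  ultimately show ?thesis by (intro exI[of _ c] conjI) simp_all
qed (intro exI[of _ a], simp)

lemma sigmoid_lipschitz: "\<bar>sigmoid b - sigmoid a\<bar> \<le> \<bar>b - a\<bar>"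
proof -
  obtain c where c: "sigmoid b - sigmoid a = (b - a) * (sigmoid c * (1 - sigmoid c))"
    using sigmoid_mean_value by blast
  have "\<bar>sigmoid c * (1 - sigmoid c)\<bar> \<le> 1"
    using sigmoid_bounds[of c] by (simp add: abs_mult mult_le_one)
  then show ?thesis unfolding c by (simp add: abs_mult mult_left_le)
qed

text \<open>By the mean value theorem the remainder is \<open>b - a\<close> times a difference of
  values of \<open>s * (1 - s)\<close> at \<open>s = sigmoid c\<close> and
  \<open>s = sigmoid a\<close>. This difference factors through
  \<open>1 - sigmoid c - sigmoid a\<close>, which lies between -1 and 1.\<close>

lemma sigmoid_quadratic_remainder:
  "\<bar>sigmoid b - sigmoid a - sigmoid a * (1 - sigmoid a) * (b - a)\<bar> \<le> (b - a)\<^sup>2"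
proof -
  obtain c where c: "\<bar>c - a\<bar> \<le> \<bar>b - a\<bar>"
    "sigmoid b - sigmoid a = (b - a) * (sigmoid c * (1 - sigmoid c))"
    using sigmoid_mean_value by blast
  have "\<bar>sigmoid c * (1 - sigmoid c) - sigmoid a * (1 - sigmoid a)\<bar> =
      \<bar>sigmoid c - sigmoid a\<bar> * \<bar>1 - sigmoid c - sigmoid a\<bar>"
    by (simp flip: abs_mult add: algebra_simps)
  also have "\<dots> \<le> \<bar>c - a\<bar> * 1"
    using sigmoid_bounds[of a] sigmoid_bounds[of c] by (intro mult_mono sigmoid_lipschitz) auto
  also have "\<dots> \<le> \<bar>b - a\<bar>" using c(1) by simp
  finally have "\<bar>b - a\<bar> * \<bar>sigmoid c * (1 - sigmoid c) - sigmoid a * (1 - sigmoid a)\<bar> \<le> \<bar>b - a\<bar> * \<bar>b - a\<bar>"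
    by (intro mult_left_mono) auto
  moreover have "sigmoid b - sigmoid a - sigmoid a * (1 - sigmoid a) * (b - a) =
      (b - a) * (sigmoid c * (1 - sigmoid c) - sigmoid a * (1 - sigmoid a))"
    unfolding c(2) by (simp add: algebra_simps)
  moreover have "(b - a)\<^sup>2 = \<bar>b - a\<bar> * \<bar>b - a\<bar>" by (simp add: power2_eq_square)
  ultimately show ?thesis by (simp only: abs_mult)
qed

text \<open>The remainder of the product is \<open>p u\<close> times the sigmoid remainder plus a
  product of two differences, each Lipschitz in \<open>v - u\<close>. The factor \<open>p u\<close>
  is bounded on the unit ball around \<open>u0\<close>.\<close>

lemma quadratically_approximable_sigmoid_unit:
  fixes p q :: "'a::euclidean_space \<Rightarrow> real"
  assumes p: "linear p" and q: "linear q"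
  shows "quadratically_approximable (\<lambda>u. p u * sigmoid (q u)) u0"
proof -
  obtain P where P: "P > 0" "\<And>h. norm (p h) \<le> P * norm h" using linear_bounded_pos[OF p] by blast
  obtain Q where Q: "Q > 0" "\<And>h. norm (q h) \<le> Q * norm h" using linear_bounded_pos[OF q] by blast
  define B where "B = P * (norm u0 + 1)"
  define s' where "s' = (\<lambda>a. sigmoid a * (1 - sigmoid a))"
  show ?thesis
  proof (rule quadratically_approximableI[of "\<lambda>u h. p h * sigmoid (q u) + p u * (s' (q u) * q h)" "B * Q\<^sup>2 + P * Q"])
    show "linear (\<lambda>h. p h * sigmoid (q u) + p u * (s' (q u) * q h))" for u
      by (intro linearI) (simp_all add: linear_add[OF p] linear_add[OF q] linear_scale[OF p] linear_scale[OF q] algebra_simps)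
    show "B * Q\<^sup>2 + P * Q \<ge> 0" using P Q by (simp add: B_def)
    fix u v assume uv: "u \<in> ball u0 1" "v \<in> ball u0 1"
    define n where "n = norm (v - u)"
    have "norm u \<le> norm u0 + dist u0 u" by (simp add: dist_norm) norm
    then have "norm u \<le> norm u0 + 1" using uv by simp
    then have "P * norm u \<le> B" using P(1) by (simp add: B_def)
    then have pu: "\<bar>p u\<bar> \<le> B" using P(2)[of u] by simp
    have pd: "\<bar>p v - p u\<bar> \<le> P * n" using P(2)[of "v - u"] by (simp add: linear_diff[OF p] n_def)
    have qd: "\<bar>q v - q u\<bar> \<le> Q * n" using Q(2)[of "v - u"] by (simp add: linear_diff[OF q] n_def)
    define e1 where "e1 = sigmoid (q v) - sigmoid (q u) - s' (q u) * (q v - q u)"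
    define e2 where "e2 = sigmoid (q v) - sigmoid (q u)"
    have "\<bar>e1\<bar> \<le> \<bar>q v - q u\<bar>\<^sup>2" using sigmoid_quadratic_remainder by (simp add: e1_def s'_def)
    also have "\<dots> \<le> (Q * n)\<^sup>2" using qd by (intro power_mono) auto
    finally have e1: "\<bar>e1\<bar> \<le> (Q * n)\<^sup>2" .
    have e2: "\<bar>e2\<bar> \<le> Q * n" using sigmoid_lipschitz qd unfolding e2_def by (rule order_trans)
    have "p v * sigmoid (q v) - p u * sigmoid (q u) -
        (p (v - u) * sigmoid (q u) + p u * (s' (q u) * q (v - u))) = p u * e1 + (p v - p u) * e2"
      by (simp add: e1_def e2_def linear_diff[OF p] linear_diff[OF q] algebra_simps)
    also have "norm \<dots> \<le> \<bar>p u\<bar> * \<bar>e1\<bar> + \<bar>p v - p u\<bar> * \<bar>e2\<bar>"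
      by (metis abs_mult abs_triangle_ineq real_norm_def)
    also have "\<dots> \<le> B * (Q * n)\<^sup>2 + (P * n) * (Q * n)"
      using pu pd e1 e2 P(1) by (intro add_mono mult_mono) (auto simp: B_def n_def)
    also have "\<dots> = (B * Q\<^sup>2 + P * Q) * (norm (v - u))\<^sup>2"
      by (simp add: n_def power2_eq_square algebra_simps)
    finally show "norm (p v * sigmoid (q v) - p u * sigmoid (q u) -
        (p (v - u) * sigmoid (q u) + p u * (s' (q u) * q (v - u)))) \<le>
        (B * Q\<^sup>2 + P * Q) * (norm (v - u))\<^sup>2" .
  qed
qed

text \<open>For a fixed input, the output weight and the argument of the sigmoid in each hidden unit
  are linear in the parameters.\<close>

lemma quadratically_approximable_network:
  fixes u0 :: "real ^ ('q::finite, 'd::finite) param_idx"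
  shows "quadratically_approximable (\<lambda>\<theta>. network \<theta> x) u0"
proof -
  have "linear (\<lambda>\<theta> :: real ^ ('q, 'd) param_idx. weight_w \<theta> i)" for i
    by (intro linearI) (simp_all add: weight_w_def)
  moreover have "linear (\<lambda>\<theta> :: real ^ ('q, 'd) param_idx. weight_v \<theta> i \<bullet> x + bias_u \<theta> i)" for i
    by (intro linearI)
      (simp_all add: weight_v_def bias_u_def inner_vec_def algebra_simps sum.distrib sum_distrib_left)
  moreover have "linear (bias_w0 :: real ^ ('q, 'd) param_idx \<Rightarrow> real)"
    by (intro linearI) (simp_all add: bias_w0_def)
  ultimately show ?thesis
    unfolding network_def
    by (intro quadratically_approximable_add quadratically_approximable_sum
        quadratically_approximable_sigmoid_unit quadratically_approximable_linear) auto
qed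

lemma quadratically_approximable_inner_fn:
  "quadratically_approximable (inner_fn l x y) u0"
proof -
  have diff: "quadratically_approximable (\<lambda>\<theta>. network \<theta> (x i) - y i) u0" for i
    using quadratically_approximable_add[OF quadratically_approximable_network[of "x i" u0]
        quadratically_approximable_const[of "- y i" u0]] by simp
  have "linear (\<lambda>c. y i * c)" for i by (intro linearI) (simp_all add: algebra_simps)
  then have prod: "quadratically_approximable (\<lambda>\<theta>. y i * network \<theta> (x i)) u0" for i
    by (rule quadratically_approximable_linear_compose[OF quadratically_approximable_network])
  have eq: "inner_fn l x y =
      (\<lambda>\<theta>. \<chi> i. if l = Hinge then y i * network \<theta> (x i) else network \<theta> (x i) - y i)"
    by (cases l) (simp_all add: fun_eq_iff)
  have "quadratically_approximable
      (\<lambda>\<theta>. if l = Hinge then y i * network \<theta> (x i) else network \<theta> (x i) - y i) u0" for i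
    using diff prod by (cases "l = Hinge") simp_all
  then show ?thesis unfolding eq by (rule quadratically_approximable_vec_lambda)
qed

section \<open>Minimizers of the losses and the final result\<close>

text \<open>Each loss is nonnegative and attains 0, so its minimizers are its zeros, where every
  summand vanishes.\<close>

lemma minimizers_outer_fn:
  "minimizers (outer_fn l :: real ^ 'm::finite \<Rightarrow> real) =
    (case l of Hinge \<Rightarrow> {z. \<forall>i. 1 \<le> z $ i} | _ \<Rightarrow> {0})"
proof -
  obtain c :: "real ^ 'm" where "outer_fn l c = 0"
  proof (cases l)
    case Hinge
    then show ?thesis using that[of "\<chi> i. 1"] by simp
  qed (use that[of 0] in auto)
  then have "z \<in> minimizers (outer_fn l) \<longleftrightarrow> outer_fn l z = 0" for z :: "real ^ 'm"
    using outer_fn_nonneg[of l] unfolding minimizers_iff by (metis order_antisym)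
  then have "minimizers (outer_fn l) = {z :: real ^ 'm. outer_fn l z = 0}" by blast
  also have "\<dots> = (case l of Hinge \<Rightarrow> {z. \<forall>i. 1 \<le> z $ i} | _ \<Rightarrow> {0})"
    by (cases l) (auto simp: sum_nonneg_eq_0_iff vec_eq_iff max_def split: if_splits)
  finally show ?thesis .
qed

lemma closed_minimizers_outer_fn: "closed (minimizers (outer_fn l :: real ^ 'm::finite \<Rightarrow> real))"
proof -
  have "closed {z :: real ^ 'm. \<forall>i. 1 \<le> z $ i}"
    by (intro closed_Collect_all closed_Collect_le continuous_intros)
  then show ?thesis by (cases l) (simp_all add: minimizers_outer_fn)
qed

lemma convex_minimizers_outer_fn: "convex (minimizers (outer_fn l :: real ^ 'm::finite \<Rightarrow> real))"
proof -
  have "{z :: real ^ 'm. \<forall>i. 1 \<le> z $ i} = (\<Inter>i. {z. 1 \<le> z $ i})" by auto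
  moreover have "convex {z :: real ^ 'm. 1 \<le> z $ i}" for i
    using convex_halfspace_ge[of 1 "axis i 1 :: real ^ 'm"] by (simp add: inner_axis')
  ultimately have "convex {z :: real ^ 'm. \<forall>i. 1 \<le> z $ i}" by (simp add: convex_INT)
  then show ?thesis by (cases l) (simp_all add: minimizers_outer_fn)
qed

theorem theorem3:
  fixes loss :: loss
    and x :: "'m::finite \<Rightarrow> real ^ 'd::finite" and y :: "'m \<Rightarrow> real"
    and F :: "real ^ ('q::finite, 'd) param_idx \<Rightarrow> real ^ 'm"
    and L :: "real ^ 'm \<Rightarrow> real"
    and \<theta>bar :: "real ^ ('q, 'd) param_idx"
    and \<beta> r :: real
  assumes "F = inner_fn loss x y" and "L = outer_fn loss"
    and "1 \<le> \<beta>" and "\<beta> \<le> 2" and "r > 0"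
    and "F \<theta>bar \<in> minimizers L"
    and "weak_sharp_minima \<beta> L (ball (F \<theta>bar) r)"
    and "regular_point F (minimizers L) \<theta>bar"
  shows "\<exists>t0\<ge>0. \<exists>rbar>0. \<forall>t>t0. \<forall>\<theta>0\<in>ball \<theta>bar rbar. \<forall>\<theta>.
           lpa_sequence F L t \<theta>0 \<theta> \<longrightarrow>
           (\<exists>\<theta>star. converges_at_rate \<theta> \<theta>star (2 / \<beta>) \<and>
              \<theta>star \<in> minimizers (\<lambda>\<theta>. L (F \<theta>)) \<and> F \<theta>star \<in> minimizers L)"
proof -
  obtain J M where "quadratic_approximation F J \<theta>bar 1 M"
    using quadratically_approximable_inner_fn[of loss x y \<theta>bar] assms(1)
    by (auto simp: quadratically_approximable_def)
  note approx = quadratic_approximation_jacobian[OF this]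
  have "closed (minimizers L)" "convex (minimizers L)"
    unfolding assms(2) by (rule closed_minimizers_outer_fn convex_minimizers_outer_fn)+
  note conv = lpa_local_convergence[OF approx this assms(3-8)]
  \<comment> \<open>Global optimality is immediate: no parameter can make
    \<open>L (F \<theta>)\<close> smaller than the minimum of \<open>L\<close>.\<close>
  have "\<theta> \<in> minimizers (\<lambda>\<theta>. L (F \<theta>))" if "F \<theta> \<in> minimizers L" for \<theta>
    using that by (simp add: minimizers_iff)
  with conv show ?thesis by meson
qed

end
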